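(* Let $n\ge 1$, let $X_0,Y_0$ be real $n\times n$ matrices with $X_0Y_0=I$, and let $\Phi,\Psi$ be invertible real $n\times n$ matrices. Let $X_0=U_xS_xV_x^\top$ and $Y_0=U_yS_yV_y^\top$ be singular value decompositions, where $U_x,V_x,U_y,V_y$ are orthogonal, $S_x=\mathrm{diag}(\alpha_1,\dots,\alpha_n)$, $S_y=\mathrm{diag}(\beta_1,\dots,\beta_n)$, and all $\alpha_i,\beta_j>0$. Put $C=-X_0\Psi-\Phi Y_0$ and $\hat C=(\hat c_{ij})=U_x^\top C V_y$, define $n\times n$ matrices $\hat X=(\hat x_{ij})$ and $\hat Y=(\hat y_{ij})$ by $$\hat x_{ij}=\frac{\hat c_{ij}\,\beta_j}{\alpha_i^2+\beta_j^2},\qquad \hat y_{ij}=\frac{\hat c_{ij}\,\alpha_i}{\alpha_i^2+\beta_j^2},$$ and set $X=U_x\hat XU_y^\top$ and $Y=V_x\hat YV_y^\top$. Then $(X,Y)$ is the unique solution of the optimization problem of minimizing $\|X'\|_{\mathrm F}^2+\|Y'\|_{\mathrm F}^2$ over all pairs of real $n\times n$ matrices $(X',Y')$ satisfying $$X_0Y'+X'Y_0=-X_0\Psi-\Phi Y_0 .$$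
   Context: $\|\cdot\|_{\mathrm F}$ is the Frobenius norm and $I$ is the $n\times n$ identity matrix. This optimization problem is the one arising in the computation of the orthogonal projection of $(\Phi,\Psi)$ onto the tangent space $T_{(X_0,Y_0)}BO(n)=\{(X,Y) : X_0Y+XY_0=0\}$ of the manifold $BO(n)=\{(X,Y): XY=I\}$ of pairs of mutually inverse matrices, after shifting variables by $(\Phi,\Psi)$. *)

theory Defs
  imports "HOL-Analysis.Analysis"
begin

text \<open>On \<^typ>\<open>real^'n^'m\<close> the library's \<^const>\<open>norm\<close> is the Frobenius norm.\<close>

lemma norm_matrix_eq_frobenius:
  fixes A :: "real^'n^'m"
  shows "norm A = sqrt (\<Sum>i\<in>UNIV. \<Sum>j\<in>UNIV. (A $ i $ j)\<^sup>2)"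
  by (simp add: norm_vec_def L2_set_def sum_nonneg)

definition diag_matrix :: "('n \<Rightarrow> real) \<Rightarrow> real^'n^'n"
  where "diag_matrix d = (\<chi> i j. if i = j then d i else 0)"

text \<open>No order is imposed on the singular values (the index type need not be ordered).\<close>

definition is_svd ::
  "real^'n^'n \<Rightarrow> real^'n^'n \<Rightarrow> ('n \<Rightarrow> real) \<Rightarrow> real^'n^'n \<Rightarrow> bool"
  where "is_svd A U s V \<longleftrightarrow>
    orthogonal_matrix U \<and> orthogonal_matrix V \<and> (\<forall>i. 0 \<le> s i) \<and>
    A = U ** diag_matrix s ** transpose V"

end

(* The orthogonal changes of basis preserve the Frobenius norm and decouple the constraint into the
   n^2 independent scalar equations alpha_i y_ij + beta_j x_ij = c_ij.  The stated x_ij, y_ij form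
   the foot of the perpendicular from the origin onto that line, so Pythagoras expresses the cost of
   any feasible pair as the optimal cost plus the squared distance to the optimum. *)

theory Submission
  imports Defs
begin

lemma diag_matrix_mult_nth: "(diag_matrix d ** A) $ i $ j = d i * A $ i $ j"
  by (simp add: diag_matrix_def matrix_matrix_mult_def if_distrib if_distribR cong: if_cong)

lemma mult_diag_matrix_nth: "(A ** diag_matrix d) $ i $ j = A $ i $ j * d j"
  by (simp add: diag_matrix_def matrix_matrix_mult_def if_distrib if_distribR cong: if_cong)

lemma matrix_add_rdistrib: "(A + B) ** C = A ** C + B ** C"
  by (simp add: matrix_matrix_mult_def vec_eq_iff distrib_right sum.distrib)

lemma matrix_sub_ldistrib:
  fixes A :: "'a::ring_1^'n^'m"
  shows "A ** (B - C) = A ** B - A ** C"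
  by (simp add: matrix_matrix_mult_def vec_eq_iff right_diff_distrib sum_subtractf)

lemma matrix_sub_rdistrib:
  fixes A :: "'a::ring_1^'n^'m"
  shows "(A - B) ** C = A ** C - B ** C"
  by (simp add: matrix_matrix_mult_def vec_eq_iff left_diff_distrib sum_subtractf)

lemma power2_norm_matrix:
  fixes A :: "real^'n^'m"
  shows "(norm A)\<^sup>2 = (\<Sum>i\<in>UNIV. \<Sum>j\<in>UNIV. (A $ i $ j)\<^sup>2)"
  by (simp add: norm_matrix_eq_frobenius sum_nonneg)

lemma norm_transpose:
  fixes A :: "real^'n^'m"
  shows "norm (transpose A) = norm A"
  unfolding norm_matrix_eq_frobenius transpose_def by (subst sum.swap) simp

text \<open>Right multiplication by \<open>Q\<close> acts on each row separately, as the isometry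
  \<open>transpose Q\<close>, and the norm of a matrix is the L2 norm of its row norms.\<close>

lemma norm_mult_orthogonal_matrix:
  fixes A :: "real^'n^'m"
  assumes "orthogonal_matrix Q"
  shows "norm (A ** Q) = norm A"
proof -
  have "orthogonal_transformation ((*v) (transpose Q))"
    using assms by (simp add: orthogonal_transformation_matrix del: transpose_matrix_vector)
  then have "norm (v v* Q) = norm v" for v
    by (metis orthogonal_transformation_norm transpose_matrix_vector)
  moreover have "(A ** Q) $ i = A $ i v* Q" for i
    by (simp add: matrix_matrix_mult_def vector_matrix_mult_def)
  ultimately show ?thesis
    by (simp add: norm_vec_def[of "A ** Q"] norm_vec_def[of A])
qed

text \<open>Transposing keeps the norm and turns a left factor into a right factor.\<close>

lemma norm_orthogonal_matrix_mult:
  fixes A :: "real^'n^'m"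
  assumes "orthogonal_matrix Q"
  shows "norm (Q ** A) = norm A"
proof -
  have "norm (Q ** A) = norm (transpose A ** transpose Q)"
    by (metis matrix_transpose_mul norm_transpose)
  then show ?thesis
    using assms by (simp add: norm_mult_orthogonal_matrix norm_transpose)
qed

text \<open>The vector \<open>(x', y')\<close> is a multiple of the normal \<open>(b, a)\<close> of
  the line and itself lies on the line, so it is orthogonal to the displacement to any other point
  of the line.\<close>

lemma pythagoras_foot_on_line:
  fixes a b c x y :: real
  assumes "a\<^sup>2 + b\<^sup>2 \<noteq> 0" and "a * y + x * b = c"
  defines "x' \<equiv> c * b / (a\<^sup>2 + b\<^sup>2)" and "y' \<equiv> c * a / (a\<^sup>2 + b\<^sup>2)"
  shows "x\<^sup>2 + y\<^sup>2 = x'\<^sup>2 + y'\<^sup>2 + ((x - x')\<^sup>2 + (y - y')\<^sup>2)"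
proof -
  define k where "k = c / (a\<^sup>2 + b\<^sup>2)"
  have x'_y': "x' = k * b" "y' = k * a"
    by (simp_all add: x'_def y'_def k_def)
  have "c = k * (a\<^sup>2 + b\<^sup>2)"
    using assms(1) by (simp add: k_def)
  \<comment> \<open>This is the cross term in the expansion of the squares; it equals
    \<open>k * (c - k * (a\<^sup>2 + b\<^sup>2))\<close>.\<close>
  then have "x' * (x - x') + y' * (y - y') = 0"
    using assms(2) unfolding x'_y' by algebra
  then show ?thesis
    by (simp add: algebra_simps power2_eq_square)
qed

text \<open>Strictness serves twice: every other feasible point is beaten by \<open>p\<close>, which
  gives uniqueness, and none of them beats \<open>p\<close>, which gives minimality.\<close>

lemma is_arg_min_set_eq_singleton:
  fixes f :: "'a \<Rightarrow> 'b::linorder"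
  assumes "P p" and "\<And>z. P z \<Longrightarrow> z \<noteq> p \<Longrightarrow> f p < f z"
  shows "{z. is_arg_min f P z} = {p}"
  using assms unfolding is_arg_min_def by (auto, force+)

theorem mainTheorem3:
  fixes X0 Y0 \<Phi> \<Psi> Ux Vx Uy Vy C Chat Xhat Yhat X Y :: "real^'n^'n"
    and \<alpha> \<beta> :: "'n \<Rightarrow> real"
  assumes "X0 ** Y0 = mat 1"
    and "invertible \<Phi>" and "invertible \<Psi>"
    and "is_svd X0 Ux \<alpha> Vx" and "\<And>i. \<alpha> i > 0"
    and "is_svd Y0 Uy \<beta> Vy" and "\<And>j. \<beta> j > 0"
    and "C = - (X0 ** \<Psi>) - \<Phi> ** Y0"
    and "Chat = transpose Ux ** C ** Vy"
    and "Xhat = (\<chi> i j. Chat $ i $ j * \<beta> j / ((\<alpha> i)\<^sup>2 + (\<beta> j)\<^sup>2))"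
    and "Yhat = (\<chi> i j. Chat $ i $ j * \<alpha> i / ((\<alpha> i)\<^sup>2 + (\<beta> j)\<^sup>2))"
    and "X = Ux ** Xhat ** transpose Uy"
    and "Y = Vx ** Yhat ** transpose Vy"
  shows "{Z. is_arg_min (\<lambda>(X', Y'). (norm X')\<^sup>2 + (norm Y')\<^sup>2)
               (\<lambda>(X', Y'). X0 ** Y' + X' ** Y0 = - (X0 ** \<Psi>) - \<Phi> ** Y0) Z}
         = {(X, Y)}"
proof (rule is_arg_min_set_eq_singleton)
  have orth: "orthogonal_matrix Ux" "orthogonal_matrix Vx" "orthogonal_matrix Uy" "orthogonal_matrix Vy"
    and X0: "X0 = Ux ** diag_matrix \<alpha> ** transpose Vx"
    and Y0: "Y0 = Uy ** diag_matrix \<beta> ** transpose Vy"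
    using assms by (auto simp: is_svd_def)
  \<comment> \<open>Simplification with \<open>matrix_mul_assoc\<close> nests products to the left,
    so cancellation is needed both after a prefix \<open>P\<close> and, in
    \<open>transpose_mult_self\<close>, at the start of a product.\<close>
  have mult_transpose_cancel: "P ** Q ** transpose Q = P" "P ** transpose Q ** Q = P"
    if "orthogonal_matrix Q" for P Q :: "real^'n^'n"
    using that by (simp_all add: orthogonal_matrix_def flip: matrix_mul_assoc)
  have transpose_mult_self: "transpose Q ** Q = mat 1" "Q ** transpose Q = mat 1"
    if "orthogonal_matrix Q" for Q :: "real^'n^'n"
    using that by (simp_all add: orthogonal_matrix_def)
  note cancel = mult_transpose_cancel transpose_mult_self orth matrix_mul_assoc
  \<comment> \<open>These maps undo the passage from \<open>Xhat\<close> to \<open>X\<close> and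
    from \<open>Yhat\<close> to \<open>Y\<close>. The bases are those for which both terms of the
    constraint acquire the same outer factors \<open>Ux\<close> and
    \<open>transpose Vy\<close>.\<close>
  define hx where "hx M = transpose Ux ** M ** Uy" for M :: "real^'n^'n"
  define hy where "hy M = transpose Vx ** M ** Vy" for M :: "real^'n^'n"
  have feasible_iff: "X0 ** Y' + X' ** Y0 = C \<longleftrightarrow>
      (\<forall>i j. \<alpha> i * hy Y' $ i $ j + hx X' $ i $ j * \<beta> j = Chat $ i $ j)" for X' Y'
  proof -
    let ?L = "X0 ** Y' + X' ** Y0"
    \<comment> \<open>Multiplying by orthogonal matrices on both sides is injective, so no
      information is lost.\<close>
    have "?L = C \<longleftrightarrow> transpose Ux ** ?L ** Vy = Chat"
    proof
      assume "transpose Ux ** ?L ** Vy = Chat"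
      then have "Ux ** (transpose Ux ** ?L ** Vy) ** transpose Vy
          = Ux ** (transpose Ux ** C ** Vy) ** transpose Vy"
        using assms(9) by simp
      then show "?L = C" by (simp add: cancel)
    qed (simp add: assms(9))
    moreover have "transpose Ux ** ?L ** Vy = diag_matrix \<alpha> ** hy Y' + hx X' ** diag_matrix \<beta>"
      by (simp add: X0 Y0 hx_def hy_def matrix_add_ldistrib matrix_add_rdistrib cancel)
    ultimately show ?thesis
      by (simp add: vec_eq_iff diag_matrix_mult_nth mult_diag_matrix_nth)
  qed
  have hX: "hx X = Xhat" and hY: "hy Y = Yhat"
    by (simp_all add: hx_def hy_def assms(12,13) cancel)
  have denom_nz: "(\<alpha> i)\<^sup>2 + (\<beta> j)\<^sup>2 \<noteq> 0" for i j
    using assms(5)[of i] by simp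
  have "\<alpha> i * Yhat $ i $ j + Xhat $ i $ j * \<beta> j = Chat $ i $ j" for i j
  proof -
    have "\<alpha> i * Yhat $ i $ j + Xhat $ i $ j * \<beta> j
        = Chat $ i $ j * ((\<alpha> i)\<^sup>2 + (\<beta> j)\<^sup>2) / ((\<alpha> i)\<^sup>2 + (\<beta> j)\<^sup>2)"
      unfolding assms(10,11)
      by (simp add: power2_eq_square distrib_left add_divide_distrib mult_ac)
    then show ?thesis using assms(5)[of i] by simp
  qed
  then show "case (X, Y) of (X', Y') \<Rightarrow> X0 ** Y' + X' ** Y0 = - (X0 ** \<Psi>) - \<Phi> ** Y0"
    using feasible_iff[of Y X] by (simp add: hX hY assms(8))
  fix Z
  assume feas: "case Z of (X', Y') \<Rightarrow> X0 ** Y' + X' ** Y0 = - (X0 ** \<Psi>) - \<Phi> ** Y0"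
    and "Z \<noteq> (X, Y)"
  obtain X' Y' where Z: "Z = (X', Y')" by (cases Z)
  have norm_h: "norm (hx M) = norm M" "norm (hy M) = norm M" for M
    using orth by (simp_all add: hx_def hy_def norm_mult_orthogonal_matrix norm_orthogonal_matrix_mult)
  have h_diff: "hx (M - N) = hx M - hx N" "hy (M - N) = hy M - hy N" for M N
    by (simp_all add: hx_def hy_def matrix_sub_ldistrib matrix_sub_rdistrib)
  have line: "\<alpha> i * hy Y' $ i $ j + hx X' $ i $ j * \<beta> j = Chat $ i $ j" for i j
    using feas feasible_iff[of Y' X'] by (simp add: Z assms(8))
  have "(hx X' $ i $ j)\<^sup>2 + (hy Y' $ i $ j)\<^sup>2 = (Xhat $ i $ j)\<^sup>2 + (Yhat $ i $ j)\<^sup>2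
      + ((hx X' $ i $ j - Xhat $ i $ j)\<^sup>2 + (hy Y' $ i $ j - Yhat $ i $ j)\<^sup>2)" for i j
    \<comment> \<open>Here \<open>a\<close>, \<open>b\<close>, \<open>c\<close> are
      \<open>\<alpha> i\<close>, \<open>\<beta> j\<close> and the entry of \<open>Chat\<close>; the
      hatted entries are the foot of the perpendicular.\<close>
    using pythagoras_foot_on_line[OF denom_nz line] by (simp add: assms(10,11))
  then have "(norm (hx X'))\<^sup>2 + (norm (hy Y'))\<^sup>2 = (norm Xhat)\<^sup>2 + (norm Yhat)\<^sup>2
      + ((norm (hx X' - Xhat))\<^sup>2 + (norm (hy Y' - Yhat))\<^sup>2)"
    by (simp add: power2_norm_matrix flip: sum.distrib)
  \<comment> \<open>Since \<open>hx\<close> and \<open>hy\<close> are additive isometries sending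
    \<open>X\<close>, \<open>Y\<close> to \<open>Xhat\<close>, \<open>Yhat\<close>, the identity
    carries over to the original matrices.\<close>
  then have "(norm X')\<^sup>2 + (norm Y')\<^sup>2 = (norm X)\<^sup>2 + (norm Y)\<^sup>2
      + ((norm (X' - X))\<^sup>2 + (norm (Y' - Y))\<^sup>2)"
    by (simp add: norm_h flip: hX hY h_diff)
  moreover have "(norm (X' - X))\<^sup>2 + (norm (Y' - Y))\<^sup>2 > 0"
    using \<open>Z \<noteq> (X, Y)\<close> by (auto simp: Z sum_power2_gt_zero_iff)
  ultimately show "(case (X, Y) of (X', Y') \<Rightarrow> (norm X')\<^sup>2 + (norm Y')\<^sup>2)
      < (case Z of (X', Y') \<Rightarrow> (norm X')\<^sup>2 + (norm Y')\<^sup>2)"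
    by (simp add: Z)
qed

end
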